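(* Let $N\ge2$ be an integer, let $\varepsilon\neq0$ be real, and let $\|\cdot\|$ be any norm on $\mathbb{R}^N$. Let $\omega(\tau_\sigma)=\|\bm{D}(\tau_\sigma)\bm{\delta}_\sigma\|$ for $\tau_\sigma\in[-1,1]\setminus\mathcal{T}_N$, with $\bm{D}(\tau_\sigma)$, $\bm{\delta}_\sigma$ and $\mathcal{T}_N$ as defined in the context. Then the global minimizer of $\omega$ is the root of the Legendre polynomial $\mathcal{P}_{N-1}$ which is nearest zero; that is, if $\pi$ is a root of $\mathcal{P}_{N-1}$ of minimal absolute value among the roots of $\mathcal{P}_{N-1}$, then $\pi\in[-1,1]\setminus\mathcal{T}_N$ and $\omega(\pi)\le\omega(\tau)$ for all $\tau\in[-1,1]\setminus\mathcal{T}_N$.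
   Context: $\mathcal{P}_n$ is the Legendre polynomial of degree $n$, and the Lobatto polynomial of degree $N\ge2$ is $\mathcal{L}_N(\tau)=(\tau^2-1)\dot{\mathcal{P}}_{N-1}(\tau)$ (a dot denotes $d/d\tau$). $\mathcal{T}_N=\{\tau_1,\dots,\tau_N\}\subset[-1,1]$ is the set of its $N$ distinct roots. Put $\sigma=N+1$, and let $\tau_\sigma=\tau_{N+1}\in[-1,1]\setminus\mathcal{T}_N$ be an additional abscissa (the exceptional sample). For $i\in\{1,\dots,N+1\}$ the Lagrange interpolating polynomials are $$l_i(\tau)=\prod_{j\in\{1,\dots,N+1\}\setminus\{i\}}\frac{\tau-\tau_j}{\tau_i-\tau_j}.$$ $\bm{D}(\tau_\sigma)\in\mathbb{R}^{N\times(N+1)}$ is the matrix with entries $\bm{D}_{ki}=\dot l_i(\tau_k)$, $k\in\{1,\dots,N\}$, $i\in\{1,\dots,N+1\}$. $\bm{\delta}_\sigma\in\mathbb{R}^{N+1}$ is the vector whose entries are all zero except the entry with index $\sigma$, which equals $\varepsilon$. *)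

theory Defs
  imports "HOL-Computational_Algebra.Polynomial" "Jordan_Normal_Form.Matrix"
begin

text \<open>Legendre polynomials by Rodrigues' formula.\<close>

definition legendre :: "nat \<Rightarrow> real poly" where
  "legendre n = Polynomial.smult (1 / (2 ^ n * fact n)) ((pderiv ^^ n) ([:-1, 0, 1:] ^ n))"

definition lobatto :: "nat \<Rightarrow> real poly" where
  "lobatto N = [:-1, 0, 1:] * pderiv (legendre (N - 1))"

definition lobatto_points :: "nat \<Rightarrow> real set" where
  "lobatto_points N = {x. poly (lobatto N) x = 0}"

text \<open>
  Indices start at 0, as is the convention for the types of vectors and matrices: the Lobatto
  points are enumerated as \<open>t 0, \<dots>, t (N - 1)\<close>, and the exceptional sample \<open>s\<close> has index \<open>N\<close>.
\<close>

definition lagrange :: "nat \<Rightarrow> (nat \<Rightarrow> real) \<Rightarrow> nat \<Rightarrow> real poly" where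
  "lagrange N t i = (\<Prod>j\<in>{..N} - {i}. Polynomial.smult (1 / (t i - t j)) [:- t j, 1:])"

definition diff_mat :: "nat \<Rightarrow> (nat \<Rightarrow> real) \<Rightarrow> real \<Rightarrow> real mat" where
  "diff_mat N t s =
     mat N (N + 1) (\<lambda>(k, i). poly (pderiv (lagrange N (t(N := s)) i)) (t k))"

definition perturbation :: "nat \<Rightarrow> real \<Rightarrow> real vec" where
  "perturbation N \<epsilon> = vec (N + 1) (\<lambda>i. if i = N then \<epsilon> else 0)"

definition is_vec_norm :: "nat \<Rightarrow> (real vec \<Rightarrow> real) \<Rightarrow> bool" where
  "is_vec_norm N \<nu> \<longleftrightarrow>
     (\<forall>v\<in>carrier_vec N. 0 \<le> \<nu> v \<and> (\<nu> v = 0 \<longleftrightarrow> v = 0\<^sub>v N)) \<and>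
     (\<forall>c. \<forall>v\<in>carrier_vec N. \<nu> (c \<cdot>\<^sub>v v) = \<bar>c\<bar> * \<nu> v) \<and>
     (\<forall>v\<in>carrier_vec N. \<forall>w\<in>carrier_vec N. \<nu> (v + w) \<le> \<nu> v + \<nu> w)"

definition omega ::
    "nat \<Rightarrow> (real vec \<Rightarrow> real) \<Rightarrow> (nat \<Rightarrow> real) \<Rightarrow> real \<Rightarrow> real \<Rightarrow> real" where
  "omega N \<nu> t \<epsilon> s = \<nu> (diff_mat N t s *\<^sub>v perturbation N \<epsilon>)"

text \<open>
  The Lobatto polynomial of degree \<open>N\<close> has \<open>N\<close> distinct roots, all in \<open>[-1, 1]\<close>; in particular
  they can be enumerated by \<open>{..<N}\<close>.
\<close>

lemma rolle_roots:
  fixes p :: "real poly"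
  assumes "finite A" "A \<noteq> {}" "\<forall>x\<in>A. poly p x = 0"
  shows "\<exists>B. finite B \<and> card B + 1 = card A \<and> (\<forall>x\<in>B. poly (pderiv p) x = 0) \<and>
           B \<subseteq> {Min A<..<Max A}"
  using assms
proof (induction A rule: finite_linorder_max_induct)
  case empty
  then show ?case by simp
next
  case (insert b A)
  show ?case
  proof (cases "A = {}")
    case True
    then show ?thesis by (intro exI[of _ "{}"]) auto
  next
    case False
    obtain B where B: "finite B" "card B + 1 = card A" "\<forall>x\<in>B. poly (pderiv p) x = 0"
      "B \<subseteq> {Min A<..<Max A}"
      using insert False by auto
    have M: "Max A \<in> A" "Min A \<in> A" using False insert by auto
    have lt: "Max A < b" using M insert by blast
    have "\<exists>z. Max A < z \<and> z < b \<and> poly p b - poly p (Max A) = (b - Max A) * poly (pderiv p) z"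
      using poly_MVT[OF lt, of p] by auto
    then obtain z where z: "Max A < z" "z < b" "poly (pderiv p) z = 0"
      using M insert.prems lt by auto
    have le: "Min A \<le> Max A" using M insert by auto
    have ext: "Max (insert b A) = b" "Min (insert b A) = Min A"
      using False insert lt le by auto
    have "z \<notin> B" "b \<notin> A" using B z insert by auto
    then show ?thesis
      unfolding ext using B z lt le insert.hyps(1)
      by (intro exI[of _ "insert z B"]) auto
  qed
qed

lemma rodrigues_roots:
  assumes "k \<le> n"
  shows "\<exists>(r :: real poly) (B :: real set). (pderiv ^^ k) ([:-1, 0, 1:] ^ n) = [:-1, 0, 1:] ^ (n - k) * r \<and>
           finite B \<and> card B = k \<and> B \<subseteq> {-1<..<1} \<and>
           (\<forall>x\<in>B. poly ((pderiv ^^ k) ([:-1, 0, 1:] ^ n)) x = 0)"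
  using assms
proof (induction k)
  case 0
  then show ?case by (intro exI[of _ 1] exI[of _ "{}"]) auto
next
  case (Suc k)
  let ?u = "[:-1, 0, 1:] :: real poly"
  let ?p = "(pderiv ^^ k) (?u ^ n)"
  obtain r B where rB: "?p = ?u ^ (n - k) * r" "finite B" "card B = k" "B \<subseteq> {-1<..<1}"
    "\<forall>x\<in>B. poly ?p x = 0"
    using Suc.IH[OF Suc_leD[OF Suc.prems]] by blast
  obtain m where m: "n - k = Suc m" "n - Suc k = m" using Suc.prems
    by (metis Suc_diff_Suc Suc_le_eq)
  have eq: "(pderiv ^^ Suc k) (?u ^ n) =
      ?u ^ (n - Suc k) * (Polynomial.smult (of_nat (Suc m)) (pderiv ?u) * r + ?u * pderiv r)"
  proof -
    have "(pderiv ^^ Suc k) (?u ^ n) = pderiv (?u ^ Suc m * r)"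
      using rB(1) m by simp
    also have "\<dots> = Polynomial.smult (of_nat (Suc m)) (?u ^ m) * pderiv ?u * r + ?u ^ Suc m * pderiv r"
      by (simp only: pderiv_mult pderiv_power_Suc mult.commute add.commute mult.assoc)
    also have "\<dots> = ?u ^ m * (Polynomial.smult (of_nat (Suc m)) (pderiv ?u) * r + ?u * pderiv r)"
      by (simp only: power_Suc distrib_left mult_smult_left mult_smult_right mult.assoc
          mult.left_commute)
    finally show ?thesis unfolding m .
  qed
  let ?A = "insert (-1) (insert 1 B)"
  have "\<forall>x\<in>?A. poly ?p x = 0" using rB m by auto
  then obtain C where C: "finite C" "card C + 1 = card ?A" "\<forall>x\<in>C. poly (pderiv ?p) x = 0"
    "C \<subseteq> {Min ?A<..<Max ?A}"
    using rolle_roots[of ?A ?p] rB(2) by auto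
  have "card ?A = k + 2" using rB by (subst card_insert_disjoint | force)+
  moreover have "Min ?A = -1" using rB by (intro Min_eqI) auto
  moreover have "Max ?A = 1" using rB by (intro Max_eqI) auto
  ultimately have "card C = Suc k" "C \<subseteq> {-1<..<1}" using C(2,4) by simp_all
  moreover have "\<forall>x\<in>C. poly ((pderiv ^^ Suc k) (?u ^ n)) x = 0" using C(3) by simp
  ultimately show ?case using C(1) eq by (intro exI conjI)
qed

lemma degree_higher_pderiv':
  "degree ((pderiv ^^ k) (p :: real poly)) = degree p - k"
  by (induction k) (auto simp: degree_pderiv)

lemma degree_legendre: "degree (legendre n) = n"
proof -
  have "degree ([:-1, 0, 1 :: real:] ^ n) = 2 * n" by (subst degree_power_eq) auto
  then show ?thesis by (simp add: legendre_def degree_higher_pderiv')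
qed

lemma lobatto_points:
  assumes "N \<ge> 2"
  shows "card (lobatto_points N) = N" "lobatto_points N \<subseteq> {-1..1}"
proof -
  define n where "n = N - 1"
  have N: "N = Suc n" "n \<ge> 1" using assms by (auto simp: n_def)
  obtain B where B: "finite B" "card B = n" "B \<subseteq> {-1<..<1}" "\<forall>x\<in>B. poly (legendre n) x = 0"
    using rodrigues_roots[of n n] by (auto simp: legendre_def)
  have "B \<noteq> {}" using B N by auto
  then obtain C where C: "finite C" "card C + 1 = n" "\<forall>x\<in>C. poly (pderiv (legendre n)) x = 0"
    "C \<subseteq> {Min B<..<Max B}"
    using rolle_roots[of B "legendre n"] B by auto
  have "Min B \<in> B" "Max B \<in> B" using B \<open>B \<noteq> {}\<close> by auto
  then have C1: "C \<subseteq> {-1<..<1}" using B C by fastforce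
  let ?A = "insert (-1) (insert 1 C)"
  have cA: "card ?A = N" using C C1 N by (subst card_insert_disjoint | force)+
  have sub: "?A \<subseteq> lobatto_points N" using C by (auto simp: lobatto_points_def lobatto_def N)
  have "degree (pderiv (legendre n)) = n - 1" by (simp add: degree_pderiv degree_legendre)
  moreover have nz: "pderiv (legendre n) \<noteq> 0" using N degree_legendre[of n]
    by (auto simp: pderiv_eq_0_iff)
  ultimately have deg: "degree (lobatto N) = N" using N
    by (simp add: lobatto_def degree_mult_eq del: mult_pCons_left)
  have "lobatto N \<noteq> 0" using deg N by auto
  then have fin: "finite (lobatto_points N)" and le: "card (lobatto_points N) \<le> N"
    using poly_roots_finite card_poly_roots_bound[of "lobatto N"] deg
    by (auto simp: lobatto_points_def)
  then have "?A = lobatto_points N" using sub cA by (intro card_seteq) auto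
  moreover have "?A \<subseteq> {-1..1}" using C1 by fastforce
  ultimately show "card (lobatto_points N) = N" "lobatto_points N \<subseteq> {-1..1}"
    using cA by simp_all
qed

lemma ex_lobatto_enumeration:
  assumes "N \<ge> 2"
  shows "\<exists>t. bij_betw t {..<N} (lobatto_points N)"
  using lobatto_points(1)[OF assms] assms
  by (intro finite_same_card_bij) (auto intro: card_ge_0_finite)

end

theory Submission
  imports Defs
begin

text \<open>
  Write \<open>L\<close> for the Lobatto polynomial of degree \<open>N\<close> and \<open>P\<close> for the Legendre polynomial of
  degree \<open>n = N - 1\<close>. The Lagrange polynomial of the exceptional sample \<open>s\<close> vanishes at all
  Lobatto points and equals \<open>1\<close> at \<open>s\<close>, so it is \<open>L / L(s)\<close> (lemma
  \<open>lagrange_exceptional_sample\<close>). Hence the vector whose norm is \<open>\<omega>(s)\<close> is \<open>\<epsilon> / L(s)\<close> times a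
  vector that does not depend on \<open>s\<close>, and minimizing \<open>\<omega>\<close> means maximizing \<open>L\<^sup>2\<close> on \<open>[-1, 1]\<close>,
  whatever the norm.

  By Legendre's differential equation, \<open>L' = n(n+1)P\<close> (lemma \<open>pderiv_lobatto\<close>). Since \<open>L\<close> is
  not zero but vanishes at \<open>1\<close> and \<open>-1\<close>, \<open>L\<^sup>2\<close> takes its maximum over \<open>[-1, 1]\<close> at a root of
  \<open>P\<close>, and it remains to compare the values of \<open>L\<^sup>2\<close> at the roots of \<open>P\<close>. This is done with
  Sonin's function \<open>S = L\<^sup>2 + n(n+1)(1 - x\<^sup>2)P\<^sup>2\<close>. It agrees with \<open>L\<^sup>2\<close> at the roots of \<open>P\<close>, it
  is even, and \<open>S' = -2n(n+1) x P\<^sup>2\<close>, so it does not increase as \<open>|x|\<close> grows (lemma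
  \<open>sonin_antimono\<close>): the root of \<open>P\<close> nearest zero wins.
\<close>

text \<open>
  With \<open>u = (x\<^sup>2 - 1)\<^sup>n\<close>, this is the \<open>(k+1)\<close>-st derivative of the identity
  \<open>(x\<^sup>2 - 1) u' = 2 n x u\<close>. The case \<open>k = n\<close> is Legendre's differential equation.
\<close>

lemma rodrigues_ode:
  fixes n k :: nat
  defines "D \<equiv> \<lambda>k. (pderiv ^^ k) ([:-1, 0, 1:] ^ n :: real poly)"
  shows "[:-1, 0, 1:] * D (k + 2) + Polynomial.smult (2 * (real k + 1 - real n)) ([:0, 1:] * D (k + 1))
         + Polynomial.smult ((real k + 1) * (real k - 2 * real n)) (D k) = 0"
proof -
  let ?u = "[:-1, 0, 1:] :: real poly"
  let ?x = "[:0, 1:] :: real poly"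
  have D_Suc: "pderiv (D k) = D (Suc k)" for k by (simp add: D_def)
  have du: "pderiv ?u = Polynomial.smult 2 ?x" and dx: "pderiv ?x = 1"
    by (simp_all add: pderiv_pCons one_pCons)
  have first_order: "?u * D 1 = Polynomial.smult (2 * real n) (?x * D 0)"
  proof (cases n)
    case 0
    then show ?thesis by (simp add: D_def pderiv_1)
  next
    case (Suc m)
    have "D 1 = Polynomial.smult (real n) (?u ^ m * pderiv ?u)"
      unfolding D_def Suc by (simp add: pderiv_power_Suc del: power_Suc)
    moreover have "D 0 = ?u * ?u ^ m" by (simp add: D_def Suc)
    ultimately show ?thesis
      unfolding du by (simp only: mult_smult_left mult_smult_right smult_smult ac_simps)
  qed
  show ?thesis
  proof (induction k)
    case 0
    have "pderiv (?u * D 1) = pderiv (Polynomial.smult (2 * real n) (?x * D 0))"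
      using first_order by simp
    then have "?u * D 2 + Polynomial.smult 2 ?x * D 1
        = Polynomial.smult (2 * real n) (?x * D 1 + D 0)"
      by (simp only: pderiv_mult pderiv_smult du dx D_Suc numeral_2_eq_2 One_nat_def
          mult_1_left mult_1_right ac_simps)
    then have "poly (?u * D 2 + Polynomial.smult 2 ?x * D 1) y
        = poly (Polynomial.smult (2 * real n) (?x * D 1 + D 0)) y" for y
      by simp
    then show ?case
      by (intro poly_ext) (simp add: algebra_simps eval_nat_numeral)
  next
    case (Suc k)
    let ?a = "2 * (real k + 1 - real n)" and ?b = "(real k + 1) * (real k - 2 * real n)"
    have "pderiv (?u * D (k + 2) + Polynomial.smult ?a (?x * D (k + 1))
        + Polynomial.smult ?b (D k)) = 0"
      using Suc.IH by simp
    then have "?u * D (k + 3) + D (k + 2) * Polynomial.smult 2 ?x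
        + Polynomial.smult ?a (?x * D (k + 2) + D (k + 1)) + Polynomial.smult ?b (D (k + 1)) = 0"
      by (simp only: pderiv_add pderiv_mult pderiv_smult du dx D_Suc mult_1_right)
         (simp add: eval_nat_numeral)
    then have "poly (?u * D (k + 3) + D (k + 2) * Polynomial.smult 2 ?x
        + Polynomial.smult ?a (?x * D (k + 2) + D (k + 1)) + Polynomial.smult ?b (D (k + 1))) y = 0"
      for y by simp
    then show ?case
      by (intro poly_ext) (simp add: algebra_simps eval_nat_numeral)
  qed
qed

lemma pderiv_lobatto:
  "pderiv (lobatto (Suc n)) = Polynomial.smult (real n * (real n + 1)) (legendre n)"
proof -
  define c :: real where "c = 1 / (2 ^ n * fact n)"
  define D where "D = (\<lambda>k. (pderiv ^^ k) ([:-1, 0, 1:] ^ n :: real poly))"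
  have P: "legendre n = Polynomial.smult c (D n)" by (simp add: legendre_def c_def D_def)
  have D_Suc: "pderiv (D k) = D (Suc k)" for k by (simp add: D_def)
  have "poly ([:-1, 0, 1:] * D (n + 2) + Polynomial.smult (2 * (real n + 1 - real n)) ([:0, 1:] * D (n + 1))
         + Polynomial.smult ((real n + 1) * (real n - 2 * real n)) (D n)) y = 0" for y
    using rodrigues_ode[of n n] by (simp add: D_def)
  then have "(y\<^sup>2 - 1) * poly (D (n + 2)) y + 2 * y * poly (D (n + 1)) y
      = real n * (real n + 1) * poly (D n) y" for y
    by (simp add: algebra_simps power2_eq_square)
  then have ode: "c * ((y\<^sup>2 - 1) * poly (D (n + 2)) y + 2 * y * poly (D (n + 1)) y)
      = c * (real n * (real n + 1) * poly (D n) y)" for y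
    by simp
  show ?thesis
  proof (rule poly_ext)
    fix y
    show "poly (pderiv (lobatto (Suc n))) y
        = poly (Polynomial.smult (real n * (real n + 1)) (legendre n)) y"
      using ode[of y]
      by (simp add: lobatto_def P pderiv_mult pderiv_smult D_Suc pderiv_pCons
          algebra_simps power2_eq_square del: mult_pCons_left mult_pCons_right)
  qed
qed

lemma poly_higher_pderiv_minus:
  fixes p :: "real poly"
  assumes "\<And>x. poly p (- x) = poly p x"
  shows "poly ((pderiv ^^ k) p) (- x) = (-1) ^ k * poly ((pderiv ^^ k) p) x"
proof (induction k arbitrary: x)
  case 0
  then show ?case using assms by simp
next
  case (Suc k)
  let ?q = "(pderiv ^^ k) p"
  have "pcompose ?q [:0, -1:] = Polynomial.smult ((-1) ^ k) ?q"
    using Suc.IH by (intro poly_ext) (simp add: poly_pcompose)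
  then have "poly (pderiv (pcompose ?q [:0, -1:])) x
      = poly (pderiv (Polynomial.smult ((-1) ^ k) ?q)) x"
    by simp
  then show ?case
    by (simp add: pderiv_pcompose pderiv_smult poly_pcompose pderiv_pCons)
qed

text \<open>Legendre polynomials are even or odd, and so are Lobatto polynomials.\<close>

lemma poly_legendre_minus_sq: "(poly (legendre n) (- x))\<^sup>2 = (poly (legendre n) x)\<^sup>2"
  and poly_lobatto_minus_sq:
    "(poly (lobatto (Suc n)) (- x))\<^sup>2 = (poly (lobatto (Suc n)) x)\<^sup>2"
proof -
  let ?p = "[:-1, 0, 1:] ^ n :: real poly"
  have sq: "(poly ((pderiv ^^ k) ?p) (- x))\<^sup>2 = (poly ((pderiv ^^ k) ?p) x)\<^sup>2" for k x
    by (subst poly_higher_pderiv_minus) (simp_all add: power_mult_distrib flip: power_mult)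
  show "(poly (legendre n) (- x))\<^sup>2 = (poly (legendre n) x)\<^sup>2"
    by (simp only: legendre_def poly_smult power_mult_distrib sq)
  have "poly (pderiv (legendre n)) y
      = 1 / (2 ^ n * fact n) * poly ((pderiv ^^ Suc n) ?p) y" for y
    by (simp add: legendre_def pderiv_smult)
  then show "(poly (lobatto (Suc n)) (- x))\<^sup>2 = (poly (lobatto (Suc n)) x)\<^sup>2"
    by (simp only: lobatto_def poly_mult power_mult_distrib diff_Suc_1 sq) simp
qed

text \<open>
  Sonin's function is even and has derivative \<open>-2n(n+1) x P\<^sup>2\<close>, which is nonpositive for
  \<open>x \<ge> 0\<close>. At roots of \<open>P\<close> the second summand vanishes, so that the lemma compares the values
  of \<open>L\<^sup>2\<close> there.
\<close>

lemma sonin_antimono: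
  fixes n :: nat
  defines "S \<equiv> \<lambda>x. (poly (lobatto (Suc n)) x)\<^sup>2
                   + real n * (real n + 1) * (1 - x\<^sup>2) * (poly (legendre n) x)\<^sup>2"
  assumes "\<bar>p\<bar> \<le> \<bar>x\<bar>"
  shows "S x \<le> S p"
proof -
  let ?L = "lobatto (Suc n)" and ?P = "legendre n"
  define c where "c = real n * (real n + 1)"
  have S_abs: "S \<bar>y\<bar> = S y" for y
    by (cases "y \<ge> 0") (simp_all add: S_def poly_legendre_minus_sq poly_lobatto_minus_sq)
  have DL: "(poly ?L has_real_derivative c * poly ?P y) (at y)" for y
    using poly_DERIV[of ?L y] by (simp add: pderiv_lobatto c_def)
  have DS: "(S has_real_derivative - 2 * c * y * (poly ?P y)\<^sup>2) (at y)" for y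
  proof -
    have "(S has_real_derivative
        2 * poly ?L y * (c * poly ?P y) + (c * (- 2 * y) * (poly ?P y)\<^sup>2
          + c * (1 - y\<^sup>2) * (2 * poly ?P y * poly (pderiv ?P) y))) (at y)"
      unfolding S_def c_def[symmetric]
      by (rule derivative_eq_intros DL poly_DERIV refl | simp)+
    \<comment> \<open>The first and the last term cancel because \<open>L = (y\<^sup>2 - 1)P'\<close>.\<close>
    moreover have "poly ?L y = (y\<^sup>2 - 1) * poly (pderiv ?P) y"
      by (simp add: lobatto_def algebra_simps power2_eq_square)
    ultimately show ?thesis by (simp add: algebra_simps)
  qed
  have "S \<bar>x\<bar> \<le> S \<bar>p\<bar>"
  proof (rule DERIV_nonpos_imp_nonincreasing[OF assms(2)])
    fix y assume "\<bar>p\<bar> \<le> y"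
    then have "- 2 * c * y * (poly ?P y)\<^sup>2 \<le> 0"
      by (simp add: c_def)
    then show "\<exists>d. (S has_real_derivative d) (at y) \<and> d \<le> 0" using DS by blast
  qed
  then show ?thesis by (simp add: S_abs)
qed

text \<open>
  Let \<open>m\<close> be a point of \<open>[-1, 1]\<close> at which \<open>L\<^sup>2\<close> is maximal. Unless \<open>L(m) = 0\<close>, \<open>m\<close> is not an
  endpoint, so \<open>2 L(m) L'(m) = 0\<close> and \<open>m\<close> is a root of \<open>P\<close>, to which Sonin's function applies.
\<close>

lemma lobatto_sq_le_at_nearest_root:
  assumes n: "n \<ge> 1" and root: "poly (legendre n) p = 0"
    and nearest: "\<forall>x. poly (legendre n) x = 0 \<longrightarrow> \<bar>p\<bar> \<le> \<bar>x\<bar>"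
    and s: "s \<in> {-1..1}"
  shows "(poly (lobatto (Suc n)) s)\<^sup>2 \<le> (poly (lobatto (Suc n)) p)\<^sup>2"
proof -
  let ?L = "lobatto (Suc n)"
  have "\<exists>m\<in>{-1..1}. \<forall>y\<in>{-1..1}. (poly ?L y)\<^sup>2 \<le> (poly ?L m)\<^sup>2"
    by (intro continuous_attains_sup) (auto intro!: continuous_intros)
  then obtain m where m: "m \<in> {-1..1}" "\<And>y. y \<in> {-1..1} \<Longrightarrow> (poly ?L y)\<^sup>2 \<le> (poly ?L m)\<^sup>2"
    by blast
  have "(poly ?L m)\<^sup>2 \<le> (poly ?L p)\<^sup>2"
  proof (cases "poly ?L m = 0")
    case True
    then show ?thesis by simp
  next
    case False
    then have "m \<noteq> 1" "m \<noteq> -1" by (auto simp: lobatto_def)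
    with m have "-1 < m" "m < 1" by auto
    have "((\<lambda>y. (poly ?L y)\<^sup>2) has_real_derivative 2 * poly ?L m * poly (pderiv ?L) m) (at m)"
      by (rule derivative_eq_intros poly_DERIV refl | simp)+
    then have "2 * poly ?L m * poly (pderiv ?L) m = 0"
      by (rule DERIV_local_max[where d = "min (1 - m) (m + 1)"])
         (use \<open>-1 < m\<close> \<open>m < 1\<close> in \<open>auto intro!: m(2)\<close>)
    then have "poly (legendre n) m = 0"
      using False n by (simp add: pderiv_lobatto)
    then show ?thesis using sonin_antimono[of p m n] nearest root by simp
  qed
  then show ?thesis using m(2)[OF s] by simp
qed

lemma degree_lobatto:
  assumes "n \<ge> 1"
  shows "degree (lobatto (Suc n)) = Suc n"
proof -
  have "pderiv (legendre n) \<noteq> 0"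
    using assms degree_legendre[of n] by (auto simp: pderiv_eq_0_iff)
  then show ?thesis using assms
    by (simp add: lobatto_def degree_mult_eq degree_pderiv degree_legendre del: mult_pCons_left)
qed

text \<open>Both sides have degree at most \<open>N\<close>, and they agree at the Lobatto points and at \<open>s\<close>.\<close>

lemma lagrange_exceptional_sample:
  assumes N: "N \<ge> 2" and t: "bij_betw t {..<N} (lobatto_points N)" and s: "s \<notin> lobatto_points N"
  shows "lagrange N (t(N := s)) N = Polynomial.smult (1 / poly (lobatto N) s) (lobatto N)"
proof -
  let ?l = "lagrange N (t(N := s)) N"
  have l: "?l = (\<Prod>j<N. Polynomial.smult (1 / (s - t j)) [:- t j, 1:])"
    unfolding lagrange_def by (rule prod.cong) auto
  have t_root: "t j \<in> lobatto_points N" if "j < N" for j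
    using t that by (auto simp: bij_betw_def)
  have "card (insert s (lobatto_points N)) = Suc N"
    using s lobatto_points(1)[OF N] N by (subst card_insert_disjoint) (auto intro: card_ge_0_finite)
  moreover have "degree ?l \<le> N"
    unfolding l by (rule order.trans[OF degree_prod_sum_le]) (auto intro!: order.trans[OF sum_bounded_above[of _ _ 1]])
  moreover have "degree (lobatto N) = N" using degree_lobatto[of "N - 1"] N by simp
  moreover have "poly ?l x = poly (Polynomial.smult (1 / poly (lobatto N) s) (lobatto N)) x"
    if "x \<in> insert s (lobatto_points N)" for x
  proof (cases "x = s")
    case True
    have "s \<noteq> t j" if "j < N" for j using t_root[OF that] s by auto
    then have "poly ?l s = 1"
      unfolding l poly_prod by (intro prod.neutral) (auto simp: diff_divide_distrib[symmetric])
    then show ?thesis using True s by (simp add: lobatto_points_def)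
  next
    case False
    then have "x \<in> t ` {..<N}" using that t by (auto simp: bij_betw_def)
    then obtain j where "j < N" "x = t j" by auto
    then have "poly ?l x = 0" unfolding l poly_prod by (intro prod_zero) auto
    then show ?thesis using False that by (simp add: lobatto_points_def)
  qed
  ultimately show ?thesis
    by (intro poly_eqI_degree[of "insert s (lobatto_points N)"]) auto
qed

lemma omega_eq:
  assumes "N \<ge> 2" "is_vec_norm N \<nu>" "bij_betw t {..<N} (lobatto_points N)"
    and "s \<notin> lobatto_points N"
  shows "omega N \<nu> t \<epsilon> s
    = \<bar>\<epsilon> / poly (lobatto N) s\<bar> * \<nu> (vec N (\<lambda>k. poly (pderiv (lobatto N)) (t k)))"
proof -
  let ?v = "vec N (\<lambda>k. poly (pderiv (lobatto N)) (t k))"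
  have "diff_mat N t s *\<^sub>v perturbation N \<epsilon> = (\<epsilon> / poly (lobatto N) s) \<cdot>\<^sub>v ?v"
  proof (rule eq_vecI)
    fix k assume "k < dim_vec ((\<epsilon> / poly (lobatto N) s) \<cdot>\<^sub>v ?v)"
    then have k: "k < N" by simp
    have "(diff_mat N t s *\<^sub>v perturbation N \<epsilon>) $ k
        = (\<Sum>i\<in>{0..<N + 1}. poly (pderiv (lagrange N (t(N := s)) i)) (t k) * (if i = N then \<epsilon> else 0))"
      using k by (simp add: diff_mat_def perturbation_def scalar_prod_def)
    also have "\<dots> = poly (pderiv (lagrange N (t(N := s)) N)) (t k) * \<epsilon>"
      by (simp add: if_distrib[where f = "\<lambda>x. _ * x"] sum.delta)
    also have "\<dots> = ((\<epsilon> / poly (lobatto N) s) \<cdot>\<^sub>v ?v) $ k"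
      using k lagrange_exceptional_sample[OF assms(1,3,4)] by (simp add: pderiv_smult)
    finally show "(diff_mat N t s *\<^sub>v perturbation N \<epsilon>) $ k
        = ((\<epsilon> / poly (lobatto N) s) \<cdot>\<^sub>v ?v) $ k" .
  qed (simp add: diff_mat_def)
  then show ?thesis
    using assms(2) by (simp add: omega_def is_vec_norm_def)
qed

theorem corollary1:
  fixes N :: nat and \<epsilon> p :: real and \<nu> :: "real vec \<Rightarrow> real" and t :: "nat \<Rightarrow> real"
  assumes "N \<ge> 2"
    and "\<epsilon> \<noteq> 0"
    and "is_vec_norm N \<nu>"
    and "bij_betw t {..<N} (lobatto_points N)"
    and "poly (legendre (N - 1)) p = 0"
    and "\<forall>x. poly (legendre (N - 1)) x = 0 \<longrightarrow> \<bar>p\<bar> \<le> \<bar>x\<bar>"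
  shows "p \<in> {-1..1} - lobatto_points N \<and>
         (\<forall>s \<in> {-1..1} - lobatto_points N. omega N \<nu> t \<epsilon> p \<le> omega N \<nu> t \<epsilon> s)"
proof -
  define n where "n = N - 1"
  have n: "n \<ge> 1" "N = Suc n" using assms(1) by (auto simp: n_def)
  have max: "(poly (lobatto N) s)\<^sup>2 \<le> (poly (lobatto N) p)\<^sup>2" if "s \<in> {-1..1}" for s
    using lobatto_sq_le_at_nearest_root[OF n(1) _ _ that] assms(5,6) n by simp
  obtain B where B: "finite B" "card B = n" "B \<subseteq> {-1<..<1}" "\<forall>x\<in>B. poly (legendre n) x = 0"
    using rodrigues_roots[of n n] by (auto simp: legendre_def)
  have "B \<noteq> {}" using B n by auto
  then obtain x where "x \<in> B" by blast
  have "\<bar>p\<bar> \<le> \<bar>x\<bar>" using \<open>x \<in> B\<close> B(4) assms(6) n by simp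
  moreover have "x \<in> {-1<..<1}" using \<open>x \<in> B\<close> B(3) by blast
  ultimately have p1: "p \<in> {-1..1}" by auto
  have p2: "p \<notin> lobatto_points N"
  proof
    \<comment> \<open>If the maximum of \<open>L\<^sup>2\<close> on \<open>[-1, 1]\<close> were zero, \<open>L\<close> would have infinitely many roots.\<close>
    assume "p \<in> lobatto_points N"
    then have "{-1..1} \<subseteq> lobatto_points N"
      using max by (auto simp: lobatto_points_def)
    moreover have "finite (lobatto_points N)"
      using lobatto_points(1)[OF assms(1)] assms(1) by (auto intro: card_ge_0_finite)
    moreover have "infinite {-1..1::real}" by simp
    ultimately show False using finite_subset by blast
  qed
  let ?v = "vec N (\<lambda>k. poly (pderiv (lobatto N)) (t k))"
  have "0 \<le> \<nu> ?v" using assms(3) by (simp add: is_vec_norm_def)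
  have "omega N \<nu> t \<epsilon> p \<le> omega N \<nu> t \<epsilon> s" if s: "s \<in> {-1..1} - lobatto_points N" for s
  proof -
    have "\<bar>poly (lobatto N) s\<bar> \<le> \<bar>poly (lobatto N) p\<bar>"
      using max[of s] s by (simp add: abs_le_square_iff)
    moreover have "0 < \<bar>poly (lobatto N) s\<bar>" using s by (simp add: lobatto_points_def)
    ultimately have "\<bar>\<epsilon> / poly (lobatto N) p\<bar> \<le> \<bar>\<epsilon> / poly (lobatto N) s\<bar>"
      unfolding abs_divide by (intro divide_left_mono mult_pos_pos) auto
    then have "\<bar>\<epsilon> / poly (lobatto N) p\<bar> * \<nu> ?v \<le> \<bar>\<epsilon> / poly (lobatto N) s\<bar> * \<nu> ?v"
      using \<open>0 \<le> \<nu> ?v\<close> by (rule mult_right_mono)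
    then show ?thesis
      using s p2 omega_eq[OF assms(1,3,4)] by simp
  qed
  then show ?thesis using p1 p2 by blast
qed

end
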